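(* Let $\mathcal{H}$ be a complex Hilbert space of finite dimension $n$, let $\mathfrak{M}$ be the set of hermitian operators on $\mathcal{H}$, and let $\mathfrak{M}/\!\sim$ be the quotient of $\mathfrak{M}$ by unitary equivalence, equipped with the addition and the multiplication by non-negative scalars defined in the context. For $A\in\mathfrak{M}$ with eigenvalues (counted with multiplicity) $\mathbf{a}=(a_1,\dots,a_n)$, set $f([A]):=\mathbf{a}^\uparrow$. Then $f:\mathfrak{M}/\!\sim\;\to{\mathbb{R}^n}^\uparrow$ is a well-defined bijection satisfying, for all $A,B\in\mathfrak{M}$ and all real $k\ge 0$, $$f([A]+[B])=f([A])+f([B]),\qquad f(k[A])=k\,f([A]).$$ In particular, $[A]=[B]$ if and only if $\mathbf{a}^\uparrow=\mathbf{b}^\uparrow$, where $\mathbf{b}$ is the vector of eigenvalues of $B$.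
   Context: For $A,B\in\mathfrak{M}$, $A\sim B$ means that there is a unitary operator $U$ on $\mathcal{H}$ with $B=UAU^\dagger$; this is an equivalence relation, $[A]$ is the equivalence class of $A$, and $\mathfrak{M}/\!\sim$ is the set of equivalence classes. For $\mathbf{x}\in\mathbb{R}^n$, $\mathbf{x}^\uparrow$ is the vector obtained by arranging the components of $\mathbf{x}$ in non-descending order, $x_1^\uparrow\le\cdots\le x_n^\uparrow$, and ${\mathbb{R}^n}^\uparrow:=\{\mathbf{x}^\uparrow:\mathbf{x}\in\mathbb{R}^n\}$, which is closed under componentwise addition and multiplication by non-negative scalars. Operations on classes: let $A$ have eigenvalues $a_1\le\cdots\le a_n$ with orthonormal eigenvectors $\ket{a_1},\dots,\ket{a_n}$, and let $B$ have eigenvalues $b_1\le\cdots\le b_n$. Then $[A]+[B]:=\left[\sum_{i}(a_i+b_i)\ket{a_i}\bra{a_i}\right]$ and, for $k\ge0$, $k[A]:=\left[k\sum_i a_i\ket{a_i}\bra{a_i}\right]$. (These classes do not depend on the choice of orthonormal basis.) *)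

theory Defs
  imports Complex_Main "Jordan_Normal_Form.Matrix"
begin

section \<open>Finite-dimensional complex Hilbert spaces\<close>

text \<open>The inner product is conjugate-linear in its first argument. In finite dimension
  completeness with respect to the induced norm is automatic.\<close>

class complex_inner_space = ab_group_add +
  fixes scaleC :: "complex \<Rightarrow> 'a \<Rightarrow> 'a" (infixr "*\<^sub>C" 75)
    and cinner :: "'a \<Rightarrow> 'a \<Rightarrow> complex"
  assumes scaleC_add_right: "c *\<^sub>C (x + y) = c *\<^sub>C x + c *\<^sub>C y"
    and scaleC_add_left: "(c + d) *\<^sub>C x = c *\<^sub>C x + d *\<^sub>C x"
    and scaleC_scaleC: "c *\<^sub>C d *\<^sub>C x = (c * d) *\<^sub>C x"
    and scaleC_one: "1 *\<^sub>C x = x"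
    and cinner_commute: "cinner x y = cnj (cinner y x)"
    and cinner_add_right: "cinner x (y + z) = cinner x y + cinner x z"
    and cinner_scaleC_right: "cinner x (c *\<^sub>C y) = c * cinner x y"
    and cinner_nonneg: "0 \<le> Re (cinner x x)"
    and cinner_eq_zero_iff: "cinner x x = 0 \<longleftrightarrow> x = 0"

global_interpretation complex_vector:
  vector_space "scaleC :: complex \<Rightarrow> 'a \<Rightarrow> 'a::complex_inner_space"
  by unfold_locales
    (simp_all add: scaleC_add_right scaleC_add_left scaleC_scaleC scaleC_one)

class fin_dim_hilbert = complex_inner_space +
  assumes finite_dim: "\<exists>S. finite S \<and> (\<forall>x. \<exists>c. x = (\<Sum>v\<in>S. c v *\<^sub>C v))"

definition cdim :: "'a::fin_dim_hilbert itself \<Rightarrow> nat" where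
  "cdim _ = complex_vector.dim (UNIV :: 'a set)"

section \<open>Operators\<close>

definition clinear :: "('a::fin_dim_hilbert \<Rightarrow> 'a) \<Rightarrow> bool" where
  "clinear A \<longleftrightarrow> Vector_Spaces.linear scaleC scaleC A"

definition hermitian_ops :: "('a::fin_dim_hilbert \<Rightarrow> 'a) set" where
  "hermitian_ops = {A. clinear A \<and> (\<forall>x y. cinner (A x) y = cinner x (A y))}"

text \<open>Every linear operator on a finite-dimensional Hilbert space has exactly one adjoint.\<close>

definition cadjoint :: "('a::fin_dim_hilbert \<Rightarrow> 'a) \<Rightarrow> 'a \<Rightarrow> 'a" where
  "cadjoint A = (THE A'. \<forall>x y. cinner (A x) y = cinner x (A' y))"

definition unitary_op :: "('a::fin_dim_hilbert \<Rightarrow> 'a) \<Rightarrow> bool" where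
  "unitary_op U \<longleftrightarrow> clinear U \<and> cadjoint U \<circ> U = id \<and> U \<circ> cadjoint U = id"

definition unitary_equiv :: "(('a::fin_dim_hilbert \<Rightarrow> 'a) \<times> ('a \<Rightarrow> 'a)) set" where
  "unitary_equiv = {(A, B). A \<in> hermitian_ops \<and> B \<in> hermitian_ops \<and>
     (\<exists>U. unitary_op U \<and> B = U \<circ> A \<circ> cadjoint U)}"

definition uclass :: "('a::fin_dim_hilbert \<Rightarrow> 'a) \<Rightarrow> ('a \<Rightarrow> 'a) set" where
  "uclass A = unitary_equiv `` {A}"

definition ket_bra :: "'a::fin_dim_hilbert \<Rightarrow> 'a \<Rightarrow> 'a \<Rightarrow> 'a" where
  "ket_bra u v = (\<lambda>x. cinner v x *\<^sub>C u)"

section \<open>Eigenvalues and ordered vectors\<close>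

text \<open>The components of \<open>a\<close> are the eigenvalues of \<open>A\<close>, in any order, each occurring as often
  as the dimension of its eigenspace. Quantifying over all complex \<open>z\<close> makes this cover
  the whole spectrum.\<close>

definition eigenvalue_vec :: "('a::fin_dim_hilbert \<Rightarrow> 'a) \<Rightarrow> real vec \<Rightarrow> bool" where
  "eigenvalue_vec A a \<longleftrightarrow> a \<in> carrier_vec (cdim TYPE('a)) \<and>
     (\<forall>z::complex. card {i. i < cdim TYPE('a) \<and> complex_of_real (a $ i) = z}
        = complex_vector.dim {x. A x = z *\<^sub>C x})"

definition ascending :: "real vec \<Rightarrow> real vec" where
  "ascending a = vec_of_list (sort (list_of_vec a))"

definition ascending_vecs :: "nat \<Rightarrow> real vec set" where
  "ascending_vecs n = ascending ` carrier_vec n"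

definition spectral_map :: "('a::fin_dim_hilbert \<Rightarrow> 'a) set \<Rightarrow> real vec" where
  "spectral_map P = (THE v. \<exists>A\<in>P. \<exists>a. eigenvalue_vec A a \<and> v = ascending a)"

section \<open>Operations on equivalence classes\<close>

definition ordered_eigensystem ::
  "('a::fin_dim_hilbert \<Rightarrow> 'a) \<Rightarrow> real vec \<Rightarrow> (nat \<Rightarrow> 'a) \<Rightarrow> bool" where
  "ordered_eigensystem A a e \<longleftrightarrow> a \<in> carrier_vec (cdim TYPE('a)) \<and>
     (\<forall>i j. i \<le> j \<longrightarrow> j < cdim TYPE('a) \<longrightarrow> a $ i \<le> a $ j) \<and>
     (\<forall>i<cdim TYPE('a). \<forall>j<cdim TYPE('a). cinner (e i) (e j) = (if i = j then 1 else 0)) \<and>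
     (\<forall>i<cdim TYPE('a). A (e i) = complex_of_real (a $ i) *\<^sub>C e i)"

text \<open>The descriptions range over all representatives and all choices of ordered orthonormal
  eigenbases, so they denote a class only because the result is independent of these choices.\<close>

definition class_add ::
  "('a::fin_dim_hilbert \<Rightarrow> 'a) set \<Rightarrow> ('a \<Rightarrow> 'a) set \<Rightarrow> ('a \<Rightarrow> 'a) set" where
  "class_add P Q = (THE C. \<exists>A\<in>P. \<exists>B\<in>Q. \<exists>a e b d.
     ordered_eigensystem A a e \<and> ordered_eigensystem B b d \<and>
     C = uclass (\<lambda>x. \<Sum>i<cdim TYPE('a). complex_of_real (a $ i + b $ i) *\<^sub>C ket_bra (e i) (e i) x))"

definition class_scale ::
  "real \<Rightarrow> ('a::fin_dim_hilbert \<Rightarrow> 'a) set \<Rightarrow> ('a \<Rightarrow> 'a) set" where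
  "class_scale k P = (THE C. \<exists>A\<in>P. \<exists>a e. ordered_eigensystem A a e \<and>
     C = uclass (\<lambda>x. complex_of_real k *\<^sub>C
           (\<Sum>i<cdim TYPE('a). complex_of_real (a $ i) *\<^sub>C ket_bra (e i) (e i) x)))"

end

theory Submission
  imports Defs "HOL-Computational_Algebra.Fundamental_Theorem_Algebra"
begin

text \<open>By the spectral theorem every hermitian operator has an orthonormal eigenbasis, and the
  ordered vector of its eigenvalues is determined by the dimensions of the eigenspaces. The
  change of basis between two orthonormal eigenbases is unitary, so two hermitian operators are
  unitarily equivalent iff their ordered eigenvalue vectors agree. Thus the classes are the
  fibres of a map onto the ascending vectors, and for an orthonormal basis \<open>e\<^sub>i\<close> and
  an ascending \<open>c\<close> the operator \<open>\<Sum> c\<^sub>i |e\<^sub>i\<rangle>\<langle>e\<^sub>i|\<close> lies in the fibre over \<open>c\<close>; this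
  identifies the class operations with the vector operations.\<close>

section \<open>Inner products and orthonormal sets\<close>

lemma cinner_zero_right [simp]: "cinner x (0::'a::complex_inner_space) = 0"
  using cinner_add_right[of x 0 0] by simp

lemma cinner_zero_left [simp]: "cinner (0::'a::complex_inner_space) x = 0"
  by (subst cinner_commute) simp

lemma cinner_add_left: "cinner (x + y) (z::'a::complex_inner_space) = cinner x z + cinner y z"
  by (metis cinner_add_right cinner_commute complex_cnj_add)

lemma cinner_scaleC_left: "cinner (c *\<^sub>C x) (y::'a::complex_inner_space) = cnj c * cinner x y"
  by (metis cinner_commute cinner_scaleC_right complex_cnj_mult)

lemma cinner_diff_right:
  "cinner x (y - z) = cinner x y - cinner x (z::'a::complex_inner_space)"
  by (metis add_diff_cancel_right' cinner_add_right diff_add_cancel)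

lemma cinner_sum_right:
  "cinner x (\<Sum>i\<in>I. f i) = (\<Sum>i\<in>I. cinner x (f i :: 'a::complex_inner_space))"
  by (induction I rule: infinite_finite_induct) (simp_all add: cinner_add_right)

lemma cinner_sum_left:
  "cinner (\<Sum>i\<in>I. f i) x = (\<Sum>i\<in>I. cinner (f i :: 'a::complex_inner_space) x)"
  by (induction I rule: infinite_finite_induct) (simp_all add: cinner_add_left)

lemma cinner_ext:
  assumes "\<And>x. cinner x y = cinner x (z::'a::complex_inner_space)"
  shows "y = z"
proof -
  have "cinner (y - z) (y - z) = 0"
    using assms by (simp add: cinner_diff_right)
  then show ?thesis
    using cinner_eq_zero_iff by (metis eq_iff_diff_eq_0)
qed

text \<open>The scalar is \<open>1 / sqrt r\<close> with \<open>r\<close> the value of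
  \<open>cinner x x\<close>, which is real by conjugate symmetry and positive by
  definiteness.\<close>

lemma ex_normalization:
  assumes "(x::'a::complex_inner_space) \<noteq> 0"
  obtains c where "cinner (c *\<^sub>C x) (c *\<^sub>C x) = 1"
proof -
  define r where "r = Re (cinner x x)"
  have "Im (cinner x x) = 0"
    using cinner_commute[of x x] by (metis cnj.simps(2) equal_neg_zero)
  then have eq: "cinner x x = of_real r"
    by (simp add: complex_eq_iff r_def)
  then have "r \<noteq> 0"
    using assms cinner_eq_zero_iff[of x] by auto
  then have "r > 0"
    using cinner_nonneg[of x] by (simp add: r_def)
  show thesis
  proof
    have "cinner (complex_of_real (1 / sqrt r) *\<^sub>C x) (complex_of_real (1 / sqrt r) *\<^sub>C x)
        = complex_of_real (1 / sqrt r * (1 / sqrt r) * r)"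
      by (simp only: cinner_scaleC_left cinner_scaleC_right eq complex_cnj_complex_of_real
          of_real_mult mult.assoc)
    also have "1 / sqrt r * (1 / sqrt r) * r = 1"
      using \<open>r > 0\<close> by (simp add: field_simps)
    also have "complex_of_real 1 = 1"
      by simp
    finally show "cinner (complex_of_real (1 / sqrt r) *\<^sub>C x) (complex_of_real (1 / sqrt r) *\<^sub>C x) = 1" .
  qed
qed

section \<open>Linear operators and the dimension bound\<close>

lemma clinear_iff:
  "clinear A \<longleftrightarrow> (\<forall>x y. A (x + y) = A x + A y) \<and> (\<forall>c x. A (c *\<^sub>C x) = c *\<^sub>C A x)"
  unfolding clinear_def Vector_Spaces.linear_iff
  using complex_vector.vector_space_axioms by blast

lemma clinear_add: "clinear A \<Longrightarrow> A (x + y) = A x + A y"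
  and clinear_scaleC: "clinear A \<Longrightarrow> A (c *\<^sub>C x) = c *\<^sub>C A x"
  by (simp_all add: clinear_iff)

lemma clinear_zero: "clinear A \<Longrightarrow> A 0 = 0"
  using clinear_scaleC[of A 0 0] by simp

lemma clinear_sum: "clinear A \<Longrightarrow> A (\<Sum>i\<in>I. g i) = (\<Sum>i\<in>I. A (g i))"
  by (induction I rule: infinite_finite_induct) (simp_all add: clinear_zero clinear_add)

text \<open>The exchange bound is used twice: against the finite spanning set \<open>S\<close> it
  makes a basis \<open>B\<close> finite, and against \<open>B\<close> it bounds \<open>E\<close>.
  This drives the maximality and counting arguments for orthonormal sets.\<close>

lemma independent_card_le_cdim:
  assumes "complex_vector.independent (E :: 'a::fin_dim_hilbert set)"
  shows "finite E" "card E \<le> cdim TYPE('a)"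
proof -
  obtain S :: "'a set" where S: "finite S" "\<forall>x. \<exists>c. x = (\<Sum>v\<in>S. c v *\<^sub>C v)"
    using finite_dim by blast
  have spS: "x \<in> complex_vector.span S" for x
  proof -
    obtain c where x: "x = (\<Sum>v\<in>S. c v *\<^sub>C v)"
      using S(2) by blast
    show ?thesis
      unfolding x
      by (intro complex_vector.span_sum complex_vector.span_scale complex_vector.span_base)
  qed
  obtain B :: "'a set" where B: "complex_vector.independent B" "UNIV \<subseteq> complex_vector.span B"
      "card B = complex_vector.dim (UNIV :: 'a set)"
    using complex_vector.basis_exists by blast
  have "finite B"
    using complex_vector.independent_span_bound[OF S(1) B(1)] spS by blast
  then show "finite E" "card E \<le> cdim TYPE('a)"
    using complex_vector.independent_span_bound[OF _ assms, of B] B by (auto simp: cdim_def)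
qed

text \<open>A set rather than a family, so that maximality can be measured by cardinality;
  \<open>orthonormal_frame\<close> is the indexed counterpart.\<close>

definition orthonormal :: "'a::complex_inner_space set \<Rightarrow> bool" where
  "orthonormal E \<longleftrightarrow> (\<forall>x\<in>E. \<forall>y\<in>E. cinner x y = (if x = y then 1 else 0))"

lemma orthonormal_subset: "orthonormal E \<Longrightarrow> F \<subseteq> E \<Longrightarrow> orthonormal F"
  unfolding orthonormal_def by blast

lemma cinner_orthonormal_sum:
  assumes "orthonormal E" "finite E" "e \<in> E"
  shows "cinner e (\<Sum>x\<in>E. c x *\<^sub>C x) = c e"
proof -
  have "cinner e (\<Sum>x\<in>E. c x *\<^sub>C x) = (\<Sum>x\<in>E. if x = e then c x else 0)"
    unfolding cinner_sum_right
    using assms by (intro sum.cong) (auto simp: cinner_scaleC_right orthonormal_def)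
  then show ?thesis
    using assms by simp
qed

text \<open>Pairing a vanishing combination with one of its vectors isolates that coefficient.
  Finiteness of \<open>E\<close> is not assumed because it is later deduced from independence; a
  dependence always lives on a finite subset.\<close>

lemma orthonormal_independent:
  assumes "orthonormal (E :: 'a::complex_inner_space set)"
  shows "complex_vector.independent E"
proof -
  have fin: "complex_vector.independent F" if "finite F" "F \<subseteq> E" for F
  proof (rule complex_vector.independent_if_scalars_zero[OF \<open>finite F\<close>])
    fix c x assume "(\<Sum>x\<in>F. c x *\<^sub>C x) = 0" "x \<in> F"
    then show "c x = 0"
      using cinner_orthonormal_sum[OF orthonormal_subset[OF assms \<open>F \<subseteq> E\<close>] \<open>finite F\<close> \<open>x \<in> F\<close>, of c]
      by simp
  qed
  show ?thesis
  proof
    assume "complex_vector.dependent E"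
    then obtain F where "finite F" "F \<subseteq> E" "complex_vector.dependent F"
      unfolding complex_vector.dependent_explicit by blast
    with fin show False by blast
  qed
qed

lemma orthonormal_insert:
  assumes "orthonormal E" "cinner y y = 1" "\<forall>e\<in>E. cinner e y = 0"
  shows "orthonormal (insert y E)" "y \<notin> E"
proof -
  have "\<forall>e\<in>E. cinner y e = 0"
    using assms(3) by (metis cinner_commute complex_cnj_zero)
  then show "orthonormal (insert y E)" "y \<notin> E"
    using assms unfolding orthonormal_def by auto
qed

text \<open>The difference of the two sides is orthogonal to all of \<open>E\<close>.\<close>

lemma orthonormal_complete_expand:
  assumes E: "orthonormal E" "finite E"
    and complete: "\<And>y. (\<forall>e\<in>E. cinner e y = 0) \<Longrightarrow> y = 0"
  shows "x = (\<Sum>e\<in>E. cinner e x *\<^sub>C e)"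
proof -
  have "x - (\<Sum>e\<in>E. cinner e x *\<^sub>C e) = 0"
    using cinner_orthonormal_sum[OF E] by (intro complete) (simp add: cinner_diff_right)
  then show ?thesis by simp
qed

lemma orthonormal_complete_card:
  assumes E: "orthonormal (E :: 'a::fin_dim_hilbert set)" "finite E"
    and complete: "\<And>y. (\<forall>e\<in>E. cinner e y = 0) \<Longrightarrow> y = 0"
  shows "card E = cdim TYPE('a)"
proof -
  have "(\<Sum>e\<in>E. cinner e x *\<^sub>C e) \<in> complex_vector.span E" for x
    by (intro complex_vector.span_sum complex_vector.span_scale complex_vector.span_base)
  then have "x \<in> complex_vector.span E" for x
    by (metis orthonormal_complete_expand[OF assms, of x])
  then have "complex_vector.span E = complex_vector.span UNIV"
    by auto
  then show ?thesis
    using complex_vector.dim_eq_card[OF _ orthonormal_independent[OF E(1)]]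
    by (simp add: cdim_def)
qed

text \<open>A nonzero \<open>y\<close> orthogonal to \<open>E\<close> could be normalized and
  adjoined, giving an independent set larger than the dimension.\<close>

lemma orthonormal_card_complete:
  assumes E: "orthonormal (E :: 'a::fin_dim_hilbert set)" "card E = cdim TYPE('a)"
    and y: "\<forall>e\<in>E. cinner e y = 0"
  shows "y = 0"
proof (rule ccontr)
  assume "y \<noteq> 0"
  then obtain c where c: "cinner (c *\<^sub>C y) (c *\<^sub>C y) = 1"
    using ex_normalization by blast
  have "orthonormal (insert (c *\<^sub>C y) E)" "c *\<^sub>C y \<notin> E"
    using orthonormal_insert[OF E(1) c] y by (auto simp: cinner_scaleC_right)
  then show False
    using independent_card_le_cdim orthonormal_independent E
    by (metis Suc_n_not_le_n card_insert_disjoint)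
qed

section \<open>Eigenvectors\<close>

text \<open>The vector p(A)x, computed by Horner's scheme.\<close>

definition poly_op :: "('a::complex_inner_space \<Rightarrow> 'a) \<Rightarrow> complex poly \<Rightarrow> 'a \<Rightarrow> 'a" where
  "poly_op A p x = fold_coeffs (\<lambda>c y. c *\<^sub>C x + A y) p 0"

lemma poly_op_0 [simp]: "poly_op A 0 x = 0"
  by (simp add: poly_op_def)

lemma poly_op_pCons:
  assumes "clinear A"
  shows "poly_op A (pCons c p) x = c *\<^sub>C x + A (poly_op A p x)"
  \<comment> \<open>In the exceptional case \<open>pCons 0 0\<close> collapses to \<open>0\<close>,
    so no Horner step takes place and A 0 = 0 is needed.\<close>
  by (cases "p = 0 \<and> c = 0") (auto simp: poly_op_def clinear_zero[OF assms])

lemma poly_op_add: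
  assumes "clinear A"
  shows "poly_op A (p + q) x = poly_op A p x + poly_op A q x"
proof (induction p q rule: poly_induct2)
  case (pCons a p b q)
  then show ?case
    by (simp add: poly_op_pCons[OF assms] clinear_add[OF assms] scaleC_add_left algebra_simps)
qed simp

lemma poly_op_smult:
  assumes "clinear A"
  shows "poly_op A (smult c p) x = c *\<^sub>C poly_op A p x"
  by (induction p)
    (simp_all add: poly_op_pCons[OF assms] clinear_scaleC[OF assms] scaleC_add_right scaleC_scaleC)

lemma poly_op_monom:
  assumes "clinear A"
  shows "poly_op A (monom 1 k) x = (A ^^ k) x"
  by (induction k) (simp_all add: monom_0 monom_Suc poly_op_pCons[OF assms] clinear_zero[OF assms] scaleC_one)

lemma poly_op_closed:
  assumes "clinear A" "complex_vector.subspace W" "\<And>x. x \<in> W \<Longrightarrow> A x \<in> W" "x \<in> W"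
  shows "poly_op A p x \<in> W"
  using assms
  by (induction p)
    (simp_all add: poly_op_pCons complex_vector.subspace_0 complex_vector.subspace_add
      complex_vector.subspace_scale)

text \<open>The iterates of \<open>x\<close> under \<open>A\<close> cannot stay independent in
  finite dimension, so some iterate is a combination of the earlier ones; that relation is the
  polynomial.\<close>

lemma ex_annihilating_poly:
  assumes A: "clinear (A :: 'a::fin_dim_hilbert \<Rightarrow> 'a)"
  shows "\<exists>p. p \<noteq> 0 \<and> poly_op A p x = 0"
proof -
  define B where "B k = (\<lambda>i. (A ^^ i) x) ` {..<k}" for k
  have "\<exists>k. (A ^^ k) x \<in> complex_vector.span (B k)"
  proof (rule ccontr)
    assume *: "\<not> ?thesis"
    have BSuc: "B (Suc k) = insert ((A ^^ k) x) (B k)" for k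
      by (simp add: B_def lessThan_Suc)
    have "complex_vector.independent (B k) \<and> card (B k) = k" for k
    proof (induction k)
      case 0
      then show ?case by (simp add: B_def complex_vector.independent_empty)
    next
      case (Suc k)
      \<comment> \<open>The new iterate is outside the span, hence outside the set, so each step
        raises the cardinality by exactly one.\<close>
      have "(A ^^ k) x \<notin> B k"
        using * complex_vector.span_base by blast
      moreover have "finite (B k)" by (simp add: B_def)
      ultimately show ?case
        using Suc * by (simp add: BSuc complex_vector.independent_insert)
    qed
    then show False
      using independent_card_le_cdim(2)[of "B (Suc (cdim TYPE('a)))"] by simp
  qed
  then obtain k where k: "(A ^^ k) x \<in> complex_vector.span (B k)" by blast
  \<comment> \<open>Polynomials of degree below \<open>k\<close>, described by coefficients so that
    the zero polynomial is included even when \<open>k\<close> is 0.\<close>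
  define R where "R = {r :: complex poly. \<forall>i\<ge>k. coeff r i = 0}"
  have "(A ^^ k) x \<in> (\<lambda>r. poly_op A r x) ` R"
    using k
  proof (induction rule: complex_vector.span_induct_alt)
    case base
    have "0 \<in> R" by (simp add: R_def)
    then show ?case by (metis imageI poly_op_0)
  next
    case (step c y z)
    then obtain i r where i: "i < k" "y = (A ^^ i) x" and r: "r \<in> R" "z = poly_op A r x"
      by (auto simp: B_def)
    have "smult c (monom 1 i) + r \<in> R"
      using i r by (auto simp: R_def)
    moreover have "c *\<^sub>C y + z = poly_op A (smult c (monom 1 i) + r) x"
      unfolding poly_op_add[OF A] poly_op_smult[OF A] poly_op_monom[OF A] i r ..
    ultimately show ?case by blast
  qed
  then obtain r where r: "r \<in> R" "(A ^^ k) x = poly_op A r x" by blast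
  \<comment> \<open>Since \<open>r\<close> has no coefficient at \<open>k\<close>, this polynomial
    is monic of degree \<open>k\<close>, hence nonzero.\<close>
  define p where "p = monom 1 k + smult (- 1) r"
  have "coeff p k = 1"
    using r(1) by (simp add: p_def R_def)
  then have "p \<noteq> 0" by auto
  moreover have "poly_op A p x = 0"
    unfolding p_def poly_op_add[OF A] poly_op_smult[OF A] poly_op_monom[OF A] r
    by (simp add: complex_vector.scale_minus_left scaleC_one)
  ultimately show ?thesis by blast
qed

text \<open>A nonzero polynomial of least degree annihilating \<open>x\<close> has a root \<open>z\<close>; the cofactor of
  the corresponding linear factor maps \<open>x\<close> to an eigenvector.\<close>

lemma ex_eigenvector_in_subspace:
  assumes A: "clinear (A :: 'a::fin_dim_hilbert \<Rightarrow> 'a)"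
    and W: "complex_vector.subspace W" "\<And>x. x \<in> W \<Longrightarrow> A x \<in> W"
    and x: "x \<in> W" "x \<noteq> 0"
  obtains w z where "w \<in> W" "w \<noteq> 0" "A w = z *\<^sub>C w"
proof -
  obtain p where p: "p \<noteq> 0" "poly_op A p x = 0"
    and least: "\<And>q. q \<noteq> 0 \<Longrightarrow> poly_op A q x = 0 \<Longrightarrow> degree p \<le> degree q"
    using exists_least_iff[of "\<lambda>d. \<exists>p. degree p = d \<and> p \<noteq> 0 \<and> poly_op A p x = 0"]
      ex_annihilating_poly[OF A, of x] by (metis not_le)
  have "degree p \<noteq> 0"
  proof
    assume "degree p = 0"
    then obtain c where c: "p = [:c:]" by (rule degree_eq_zeroE)
    then show False
      using p x by (simp add: poly_op_pCons[OF A] clinear_zero[OF A])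
  qed
  then have "\<not> constant (poly p)"
    by (simp add: constant_degree)
  then obtain z where "poly p z = 0"
    using fundamental_theorem_of_algebra by blast
  then obtain q where q: "p = [:- z, 1:] * q"
    by (auto simp: poly_eq_0_iff_dvd)
  have "q \<noteq> 0" using q p by auto
  then have "degree p = Suc (degree q)"
    unfolding q by (subst degree_mult_eq) auto
  with least[OF \<open>q \<noteq> 0\<close>] have "poly_op A q x \<noteq> 0" by force
  \<comment> \<open>Written this way, p(A)x = 0 says that \<open>A\<close> multiplies q(A)x by
    \<open>z\<close>; q(A)x is nonzero because \<open>q\<close> has smaller degree than the minimal
    \<open>p\<close>.\<close>
  moreover have "p = smult (- z) q + pCons 0 q"
    by (simp add: q)
  then have "A (poly_op A q x) = z *\<^sub>C poly_op A q x"
    using p(2) by (simp add: poly_op_add[OF A] poly_op_smult[OF A, of "- z"] poly_op_pCons[OF A]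
        del: smult_minus_left)
  ultimately show thesis
    using that poly_op_closed[OF A W x(1)] by blast
qed

section \<open>The spectral theorem for hermitian operators\<close>

lemma hermitian_eigenvalue_real:
  assumes "A \<in> hermitian_ops" "A w = z *\<^sub>C w" "w \<noteq> 0"
  shows "z = complex_of_real (Re z)"
proof -
  have "cinner (A w) w = cinner w (A w)"
    using assms(1) unfolding hermitian_ops_def by blast
  then have "cnj z = z"
    using assms cinner_eq_zero_iff[of w] by (simp add: cinner_scaleC_left cinner_scaleC_right)
  then show ?thesis
    by (simp add: complex_eq_iff)
qed

text \<open>A maximal orthonormal set of eigenvectors is complete: its orthogonal complement is
  invariant, so it would otherwise contain a further eigenvector.\<close>

lemma ex_orthonormal_eigenbasis:
  assumes A: "A \<in> hermitian_ops"
  obtains E and g :: "'a::fin_dim_hilbert \<Rightarrow> real"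
  where "orthonormal E" "finite E" "card E = cdim TYPE('a)"
    "\<And>e. e \<in> E \<Longrightarrow> A e = complex_of_real (g e) *\<^sub>C e"
proof -
  have lin: "clinear A" and herm: "\<And>x y. cinner (A x) y = cinner x (A y)"
    using A by (auto simp: hermitian_ops_def)
  define P where "P E \<longleftrightarrow> orthonormal E \<and> (\<forall>e\<in>E. \<exists>z. A e = z *\<^sub>C e)" for E
  have bound: "finite E \<and> card E \<le> cdim TYPE('a)" if "P E" for E
    using that independent_card_le_cdim orthonormal_independent unfolding P_def by blast
  have "P {}" by (simp add: P_def orthonormal_def)
  moreover have "\<forall>F. P F \<longrightarrow> card F < Suc (cdim TYPE('a))"
    using bound by (simp add: less_Suc_eq_le)
  ultimately obtain E where E: "P E" and max: "\<And>F. P F \<Longrightarrow> card F \<le> card E"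
    using ex_has_greatest_nat[of P "{}" card "Suc (cdim TYPE('a))"] by blast
  have on: "orthonormal E" and eig: "\<forall>e\<in>E. \<exists>z. A e = z *\<^sub>C e"
    using E by (auto simp: P_def)
  have fin: "finite E" using bound[OF E] by simp
  define W where "W = {y. \<forall>e\<in>E. cinner e y = 0}"
  have sub: "complex_vector.subspace W"
    by (auto simp: complex_vector.subspace_def W_def cinner_add_right cinner_scaleC_right)
  have inv: "A y \<in> W" if "y \<in> W" for y
  proof -
    \<comment> \<open>Hermiticity moves \<open>A\<close> onto \<open>e\<close>, where it becomes a
      scalar.\<close>
    have "cinner e (A y) = 0" if "e \<in> E" for e
      using eig \<open>y \<in> W\<close> that herm[of e y] by (auto simp: W_def cinner_scaleC_left)
    then show ?thesis by (simp add: W_def)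
  qed
  have complete: "y = 0" if "\<forall>e\<in>E. cinner e y = 0" for y
  proof (rule ccontr)
    assume "y \<noteq> 0"
    moreover have "y \<in> W" using that by (simp add: W_def)
    ultimately obtain w z where w: "w \<in> W" "w \<noteq> 0" "A w = z *\<^sub>C w"
      using ex_eigenvector_in_subspace[OF lin sub inv] by metis
    obtain c where c: "cinner (c *\<^sub>C w) (c *\<^sub>C w) = 1"
      using ex_normalization[OF w(2)] by blast
    have *: "orthonormal (insert (c *\<^sub>C w) E)" "c *\<^sub>C w \<notin> E"
      using orthonormal_insert[OF on c] w(1) by (auto simp: cinner_scaleC_right W_def)
    have "A (c *\<^sub>C w) = z *\<^sub>C c *\<^sub>C w"
      by (simp add: clinear_scaleC[OF lin] w(3) scaleC_scaleC mult.commute)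
    then have "P (insert (c *\<^sub>C w) E)"
      using * eig by (auto simp: P_def)
    then show False
      using max *(2) fin by fastforce
  qed
  have "\<exists>r::real. A e = complex_of_real r *\<^sub>C e" if "e \<in> E" for e
  proof -
    have "e \<noteq> 0" using on that by (force simp: orthonormal_def)
    then show ?thesis using eig that hermitian_eigenvalue_real[OF A] by metis
  qed
  then obtain g where "\<And>e. e \<in> E \<Longrightarrow> A e = complex_of_real (g e) *\<^sub>C e"
    by metis
  then show thesis
    using that on fin orthonormal_complete_card[OF on fin complete] by blast
qed

lemma hermitian_ex_ordered_eigensystem:
  assumes "A \<in> hermitian_ops"
  obtains a e where "ordered_eigensystem A a e"
proof -
  obtain E and g :: "'a \<Rightarrow> real" where E: "orthonormal E" "finite E" "card E = cdim TYPE('a)"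
    "\<And>e. e \<in> E \<Longrightarrow> A e = complex_of_real (g e) *\<^sub>C e"
    using ex_orthonormal_eigenbasis[OF assms] by metis
  obtain xs where xs: "set xs = E" "distinct xs"
    using finite_distinct_list[OF E(2)] by blast
  \<comment> \<open>Sorting the basis vectors by eigenvalue turns the set \<open>E\<close> into an
    indexed eigenbasis with ascending eigenvalues.\<close>
  define ys where "ys = sort_key g xs"
  have ys: "set ys = E" "distinct ys" "sorted (map g ys)"
    using xs by (simp_all add: ys_def)
  have len: "length ys = cdim TYPE('a)"
    using ys E(3) by (metis distinct_card)
  have inE: "ys ! i \<in> E" if "i < cdim TYPE('a)" for i
    using that len ys by auto
  have "ordered_eigensystem A (vec (cdim TYPE('a)) (\<lambda>i. g (ys ! i))) ((!) ys)"
    unfolding ordered_eigensystem_def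
  proof (intro conjI allI impI)
    fix i j assume "i \<le> j" "j < cdim TYPE('a)"
    then show "vec (cdim TYPE('a)) (\<lambda>i. g (ys ! i)) $ i \<le> vec (cdim TYPE('a)) (\<lambda>i. g (ys ! i)) $ j"
      using sorted_nth_mono[OF ys(3), of i j] len by simp
  next
    fix i j assume ij: "i < cdim TYPE('a)" "j < cdim TYPE('a)"
    then have "ys ! i = ys ! j \<longleftrightarrow> i = j"
      using ys(2) len by (simp add: nth_eq_iff_index_eq)
    then show "cinner (ys ! i) (ys ! j) = (if i = j then 1 else 0)"
      using E(1) inE ij by (simp add: orthonormal_def)
  qed (use E(4) inE in auto)
  then show thesis by (rule that)
qed

section \<open>Orthonormal frames\<close>

text \<open>The orthonormality clause of \<open>ordered_eigensystem\<close> in isolation; values of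
  \<open>e\<close> from index \<open>cdim\<close> on are arbitrary.\<close>

definition orthonormal_frame :: "(nat \<Rightarrow> 'a::fin_dim_hilbert) \<Rightarrow> bool" where
  "orthonormal_frame e \<longleftrightarrow>
     (\<forall>i<cdim TYPE('a). \<forall>j<cdim TYPE('a). cinner (e i) (e j) = (if i = j then 1 else 0))"

context
  fixes e :: "nat \<Rightarrow> 'a::fin_dim_hilbert"
  assumes e: "orthonormal_frame e"
begin

lemma frame_inj_on: "inj_on e {..<cdim TYPE('a)}"
proof (rule inj_onI)
  fix i j assume "i \<in> {..<cdim TYPE('a)}" "j \<in> {..<cdim TYPE('a)}" "e i = e j"
  then show "i = j"
    using e unfolding orthonormal_frame_def by (metis lessThan_iff zero_neq_one)
qed

lemma frame_orthonormal: "orthonormal (e ` {..<cdim TYPE('a)})"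
  unfolding orthonormal_def
proof (intro ballI)
  fix x y assume "x \<in> e ` {..<cdim TYPE('a)}" "y \<in> e ` {..<cdim TYPE('a)}"
  then obtain i j where ij: "i < cdim TYPE('a)" "j < cdim TYPE('a)" "x = e i" "y = e j"
    by blast
  moreover have "e i = e j \<longleftrightarrow> i = j"
    using ij by (intro inj_on_eq_iff[OF frame_inj_on]) auto
  ultimately show "cinner x y = (if x = y then 1 else 0)"
    using e by (simp add: orthonormal_frame_def)
qed

text \<open>Injectivity gives the frame as many vectors as the dimension, which makes it
  complete.\<close>

lemma frame_expand: "x = (\<Sum>i<cdim TYPE('a). cinner (e i) x *\<^sub>C e i)"
proof -
  have card: "card (e ` {..<cdim TYPE('a)}) = cdim TYPE('a)"
    using frame_inj_on by (simp add: card_image)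
  have "x = (\<Sum>v\<in>e ` {..<cdim TYPE('a)}. cinner v x *\<^sub>C v)"
    by (rule orthonormal_complete_expand[OF frame_orthonormal])
      (use orthonormal_card_complete[OF frame_orthonormal card] in auto)
  then show ?thesis
    using frame_inj_on by (simp add: sum.reindex)
qed

lemma frame_cinner_sum:
  assumes "i < cdim TYPE('a)"
  shows "cinner (e i) (\<Sum>j<cdim TYPE('a). c j *\<^sub>C e j) = c i"
proof -
  have "cinner (e i) (\<Sum>j<cdim TYPE('a). c j *\<^sub>C e j) = (\<Sum>j<cdim TYPE('a). if j = i then c j else 0)"
    unfolding cinner_sum_right
    using e assms by (intro sum.cong) (auto simp: cinner_scaleC_right orthonormal_frame_def)
  then show ?thesis
    using assms by simp
qed

lemma clinear_frame_expand:
  assumes "clinear A"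
  shows "A x = (\<Sum>i<cdim TYPE('a). cinner (e i) x *\<^sub>C A (e i))"
proof -
  have "A x = A (\<Sum>i<cdim TYPE('a). cinner (e i) x *\<^sub>C e i)"
    using frame_expand[of x] by (rule arg_cong)
  also have "\<dots> = (\<Sum>i<cdim TYPE('a). cinner (e i) x *\<^sub>C A (e i))"
    by (simp add: clinear_sum[OF assms] clinear_scaleC[OF assms])
  finally show ?thesis .
qed

lemma clinear_frame_map: "clinear (\<lambda>x. \<Sum>i<cdim TYPE('a). cinner (e i) x *\<^sub>C d i)"
  by (simp add: clinear_iff cinner_add_right scaleC_add_left sum.distrib cinner_scaleC_right
      scaleC_scaleC complex_vector.scale_sum_right)

text \<open>The adjoint of \<Sum> |d_i><e_i| is \<Sum> |e_i><d_i|. The family \<open>d\<close> is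
  arbitrary, so this serves changes of basis, general linear operators (with
  \<open>d i = A (e i)\<close>) and diagonal operators alike.\<close>

lemma frame_map_adjoint:
  "cinner (\<Sum>i<cdim TYPE('a). cinner (e i) x *\<^sub>C d i) y =
   cinner x (\<Sum>i<cdim TYPE('a). cinner (d i) y *\<^sub>C e i)"
  unfolding cinner_sum_left cinner_sum_right cinner_scaleC_left cinner_scaleC_right
  by (intro sum.cong refl) (simp add: cinner_commute[of x] mult.commute)

end

section \<open>Adjoints and unitary operators\<close>

lemma cadjoint_eqI:
  assumes "\<And>x y. cinner (A x) y = cinner x (A' y)"
  shows "cadjoint A = A'"
  unfolding cadjoint_def
proof (rule the_equality)
  fix B assume B: "\<forall>x y. cinner (A x) y = cinner x (B y)"
  show "B = A'"
    using B assms by (intro ext cinner_ext) metis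
qed (use assms in blast)

text \<open>\<open>U\<close> sends each \<open>e i\<close> to \<open>d i\<close>, and its adjoint is
  the same construction with the frames exchanged, so both composites reduce to frame
  expansions.\<close>

lemma frame_change_unitary:
  fixes e d :: "nat \<Rightarrow> 'a::fin_dim_hilbert"
  assumes e: "orthonormal_frame e" and d: "orthonormal_frame d"
  defines "U \<equiv> \<lambda>x. \<Sum>i<cdim TYPE('a). cinner (e i) x *\<^sub>C d i"
  shows "unitary_op U" "cadjoint U = (\<lambda>y. \<Sum>i<cdim TYPE('a). cinner (d i) y *\<^sub>C e i)"
proof -
  show adj: "cadjoint U = (\<lambda>y. \<Sum>i<cdim TYPE('a). cinner (d i) y *\<^sub>C e i)"
    unfolding U_def by (rule cadjoint_eqI) (rule frame_map_adjoint[OF e])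
  have 1: "cadjoint U (U x) = x" for x
    using frame_expand[OF e, of x] unfolding adj by (simp add: frame_cinner_sum[OF d] U_def)
  have 2: "U (cadjoint U x) = x" for x
    using frame_expand[OF d, of x] unfolding adj by (simp add: frame_cinner_sum[OF e] U_def)
  show "unitary_op U"
    unfolding unitary_op_def using 1 2 clinear_frame_map[OF e, of d] by (auto simp: U_def)
qed

lemma cinner_cadjoint:
  fixes A :: "'a::fin_dim_hilbert \<Rightarrow> 'a"
  assumes "clinear A"
  shows "cinner (A x) y = cinner x (cadjoint A y)"
proof -
  \<comment> \<open>The zero operator serves only to produce some orthonormal frame of the
    space.\<close>
  have "(\<lambda>x::'a. 0) \<in> hermitian_ops"
    by (simp add: hermitian_ops_def clinear_iff)
  then obtain a and e :: "nat \<Rightarrow> 'a" where "ordered_eigensystem (\<lambda>x. 0) a e"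
    by (rule hermitian_ex_ordered_eigensystem)
  then have e: "orthonormal_frame e"
    by (simp add: ordered_eigensystem_def orthonormal_frame_def)
  have *: "cinner (A x) y = cinner x (\<Sum>i<cdim TYPE('a). cinner (A (e i)) y *\<^sub>C e i)" for x y
    unfolding clinear_frame_expand[OF e assms, of x] by (rule frame_map_adjoint[OF e])
  show ?thesis
    unfolding cadjoint_eqI[OF *] by (rule *)
qed

lemma unitary_op_cinner:
  assumes "unitary_op U"
  shows "cinner (U x) (U y) = cinner x y"
proof -
  have "cadjoint U (U y) = y"
    using assms by (metis comp_apply id_apply unitary_op_def)
  then show ?thesis
    using assms cinner_cadjoint[of U x "U y"] by (simp add: unitary_op_def)
qed

section \<open>The eigenvalues of a hermitian operator\<close>

lemma frame_of_eigensystem: "ordered_eigensystem A a e \<Longrightarrow> orthonormal_frame e"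
  by (simp add: ordered_eigensystem_def orthonormal_frame_def)

text \<open>The eigenspace \<open>V\<close> of \<open>z\<close> is spanned by the frame vectors
  whose index lies in \<open>I\<close>, so its dimension is the number of those indices. If
  \<open>z\<close> does not occur in \<open>a\<close>, both numbers are 0.\<close>

lemma eigensystem_eigenvalue_vec:
  fixes A :: "'a::fin_dim_hilbert \<Rightarrow> 'a"
  assumes A: "clinear A" and sys: "ordered_eigensystem A a e"
  shows "eigenvalue_vec A a"
  unfolding eigenvalue_vec_def
proof (intro conjI allI)
  show "a \<in> carrier_vec (cdim TYPE('a))"
    using sys by (simp add: ordered_eigensystem_def)
next
  fix z
  note e = frame_of_eigensystem[OF sys]
  have Ae: "A (e i) = complex_of_real (a $ i) *\<^sub>C e i" if "i < cdim TYPE('a)" for i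
    using sys that by (simp add: ordered_eigensystem_def)
  define I where "I = {i. i < cdim TYPE('a) \<and> complex_of_real (a $ i) = z}"
  define V where "V = {x. A x = z *\<^sub>C x}"
  have sub: "complex_vector.subspace V"
    by (simp add: complex_vector.subspace_def V_def clinear_zero[OF A] clinear_add[OF A]
        clinear_scaleC[OF A] scaleC_add_right scaleC_scaleC mult.commute)
  have "e ` I \<subseteq> V"
    using Ae by (auto simp: I_def V_def)
  then have 1: "complex_vector.span (e ` I) \<subseteq> V"
    using sub by (rule complex_vector.span_minimal)
  have 2: "x \<in> complex_vector.span (e ` I)" if "x \<in> V" for x
  proof -
    have "A x = (\<Sum>i<cdim TYPE('a). (cinner (e i) x * complex_of_real (a $ i)) *\<^sub>C e i)"
      unfolding clinear_frame_expand[OF e A, of x] by (simp add: Ae scaleC_scaleC)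
    then have "cinner (e i) (A x) = cinner (e i) x * complex_of_real (a $ i)"
      if "i < cdim TYPE('a)" for i
      using frame_cinner_sum[OF e that] by simp
    moreover have "cinner (e i) (A x) = z * cinner (e i) x" for i
      using \<open>x \<in> V\<close> by (simp add: V_def cinner_scaleC_right)
    \<comment> \<open>Comparing the two expressions gives (a_i - z) <e_i, x> = 0.\<close>
    ultimately have zero: "cinner (e i) x = 0" if "i < cdim TYPE('a)" "i \<notin> I" for i
      using that by (fastforce simp: I_def)
    have "cinner (e i) x *\<^sub>C e i \<in> complex_vector.span (e ` I)" if "i < cdim TYPE('a)" for i
    proof (cases "i \<in> I")
      case True
      then show ?thesis
        by (intro complex_vector.span_scale complex_vector.span_base imageI)
    next
      case False
      then show ?thesis
        using zero[OF that] by (simp add: complex_vector.span_zero)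
    qed
    then have "(\<Sum>i<cdim TYPE('a). cinner (e i) x *\<^sub>C e i) \<in> complex_vector.span (e ` I)"
      by (intro complex_vector.span_sum) simp
    then show ?thesis
      by (metis frame_expand[OF e, of x])
  qed
  have I: "I \<subseteq> {..<cdim TYPE('a)}" by (auto simp: I_def)
  have "complex_vector.dim V = complex_vector.dim (complex_vector.span (e ` I))"
    using 1 2 by (metis subsetI subset_antisym)
  also have "\<dots> = card (e ` I)"
    by (intro complex_vector.dim_span_eq_card_independent orthonormal_independent
        orthonormal_subset[OF frame_orthonormal[OF e]] image_mono I)
  also have "\<dots> = card I"
    by (intro card_image inj_on_subset[OF frame_inj_on[OF e] I])
  finally show "card {i. i < cdim TYPE('a) \<and> complex_of_real (a $ i) = z}
      = complex_vector.dim {x. A x = z *\<^sub>C x}"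
    by (simp add: I_def V_def)
qed

text \<open>The dimensions of the eigenspaces fix the multiset of components, and sorting depends
  only on that multiset.\<close>

lemma eigenvalue_vec_ascending_unique:
  fixes A :: "'a::fin_dim_hilbert \<Rightarrow> 'a"
  assumes "eigenvalue_vec A a" "eigenvalue_vec A b"
  shows "ascending a = ascending b"
proof -
  have count: "count (mset (list_of_vec v)) x
      = complex_vector.dim {y. A y = complex_of_real x *\<^sub>C y}"
    if "eigenvalue_vec A v" for v x
  proof -
    have v: "dim_vec v = cdim TYPE('a)"
      using that by (simp add: eigenvalue_vec_def)
    have "count (mset (list_of_vec v)) x
        = card {i. i < cdim TYPE('a) \<and> x = v $ i}"
      unfolding count_mset by (simp add: count_list_eq_length_filter length_filter_conv_card v list_of_vec_index)
    also have "\<dots> = card {i. i < cdim TYPE('a) \<and> complex_of_real (v $ i) = complex_of_real x}"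
      by (intro arg_cong[of _ _ card]) auto
    finally show ?thesis
      using that unfolding eigenvalue_vec_def by metis
  qed
  have "mset (list_of_vec a) = mset (list_of_vec b)"
    using count[OF assms(1)] count[OF assms(2)] by (intro multiset_eqI) simp
  then show ?thesis
    unfolding ascending_def by (metis sorted_list_of_multiset_mset)
qed

lemma ascending_id:
  assumes "\<And>i j. i \<le> j \<Longrightarrow> j < dim_vec a \<Longrightarrow> a $ i \<le> a $ j"
  shows "ascending a = a"
proof -
  have "sorted (list_of_vec a)"
    using assms by (simp add: sorted_iff_nth_mono list_of_vec_index)
  then show ?thesis
    by (simp add: ascending_def sorted_sort_id vec_list)
qed

text \<open>The counterpart of \<open>spectral_map\<close> for a single operator, separating the
  choice of eigenvalue order from the choice of representative.\<close>

definition eigs :: "('a::fin_dim_hilbert \<Rightarrow> 'a) \<Rightarrow> real vec" where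
  "eigs A = (THE v. \<exists>a. eigenvalue_vec A a \<and> v = ascending a)"

lemma eigs_eq:
  assumes "eigenvalue_vec A a"
  shows "eigs A = ascending a"
  unfolding eigs_def
proof (rule the_equality)
  show "\<exists>b. eigenvalue_vec A b \<and> ascending a = ascending b"
    using assms by blast
next
  fix v assume "\<exists>b. eigenvalue_vec A b \<and> v = ascending b"
  then show "v = ascending a"
    using eigenvalue_vec_ascending_unique[OF _ assms] by blast
qed

text \<open>The vector of an ordered eigensystem is already sorted, so it does not depend on the
  eigenbasis.\<close>

lemma eigs_eigensystem:
  assumes "A \<in> hermitian_ops" "ordered_eigensystem A a e"
  shows "eigs A = a"
proof -
  have "eigs A = ascending a"
    using assms by (intro eigs_eq eigensystem_eigenvalue_vec) (auto simp: hermitian_ops_def)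
  also have "\<dots> = a"
    using assms(2) by (intro ascending_id) (auto simp: ordered_eigensystem_def)
  finally show ?thesis .
qed

lemma hermitian_ex_eigensystem:
  assumes "A \<in> hermitian_ops"
  obtains e where "ordered_eigensystem A (eigs A) e"
proof -
  obtain a e where "ordered_eigensystem A a e"
    using hermitian_ex_ordered_eigensystem[OF assms] .
  with that eigs_eigensystem[OF assms this] show thesis by simp
qed

lemma hermitian_ex_eigenvalue_vec:
  assumes "A \<in> hermitian_ops"
  shows "eigenvalue_vec A (eigs A)"
proof -
  obtain e where "ordered_eigensystem A (eigs A) e"
    using hermitian_ex_eigensystem[OF assms] .
  moreover have "clinear A"
    using assms by (simp add: hermitian_ops_def)
  ultimately show ?thesis
    by (intro eigensystem_eigenvalue_vec)
qed

text \<open>Each \<open>e i\<close> is an eigenvector for \<open>c i\<close>, and monotonicity of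
  \<open>c\<close> makes this an ordered eigensystem.\<close>

lemma diagonal_operator:
  fixes e :: "nat \<Rightarrow> 'a::fin_dim_hilbert"
  assumes e: "orthonormal_frame e"
    and c: "\<forall>i j. i \<le> j \<longrightarrow> j < cdim TYPE('a) \<longrightarrow> c i \<le> c j"
  defines "D \<equiv> \<lambda>x. \<Sum>i<cdim TYPE('a). complex_of_real (c i) *\<^sub>C ket_bra (e i) (e i) x"
  shows "D \<in> hermitian_ops" "eigs D = vec (cdim TYPE('a)) c"
proof -
  \<comment> \<open>This is a frame map with \<open>d i\<close> equal to c_i e_i, so the general
    linearity and adjoint facts apply.\<close>
  have D: "D x = (\<Sum>i<cdim TYPE('a). cinner (e i) x *\<^sub>C complex_of_real (c i) *\<^sub>C e i)" for x
    by (simp add: D_def ket_bra_def scaleC_scaleC mult.commute)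
  have "clinear D"
    unfolding D[abs_def] by (rule clinear_frame_map[OF e])
  moreover have "cinner (D x) y = cinner x (D y)" for x y
    unfolding D frame_map_adjoint[OF e]
    by (simp add: cinner_scaleC_left scaleC_scaleC mult.commute)
  ultimately show herm: "D \<in> hermitian_ops"
    by (simp add: hermitian_ops_def)
  have "D (e i) = complex_of_real (c i) *\<^sub>C e i" if "i < cdim TYPE('a)" for i
  proof -
    have "D (e i) = (\<Sum>j<cdim TYPE('a). if j = i then complex_of_real (c j) *\<^sub>C e j else 0)"
      unfolding D using e that
      by (intro sum.cong) (auto simp: orthonormal_frame_def scaleC_one)
    then show ?thesis
      using that by simp
  qed
  then have "ordered_eigensystem D (vec (cdim TYPE('a)) c) e"
    using e c by (auto simp: ordered_eigensystem_def orthonormal_frame_def)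
  then show "eigs D = vec (cdim TYPE('a)) c"
    by (rule eigs_eigensystem[OF herm])
qed

lemma eigs_carrier: "A \<in> hermitian_ops \<Longrightarrow> eigs A \<in> carrier_vec (cdim TYPE('a))"
  for A :: "'a::fin_dim_hilbert \<Rightarrow> 'a"
  using hermitian_ex_eigenvalue_vec by (auto simp: eigenvalue_vec_def)

text \<open>Every ascending vector is realized by a diagonal operator on some frame.\<close>

lemma eigs_range: "eigs ` (hermitian_ops :: ('a::fin_dim_hilbert \<Rightarrow> 'a) set) = ascending_vecs (cdim TYPE('a))"
proof (intro equalityI subsetI)
  fix v assume "v \<in> eigs ` (hermitian_ops :: ('a \<Rightarrow> 'a) set)"
  then obtain A :: "'a \<Rightarrow> 'a" where A: "A \<in> hermitian_ops" "v = eigs A" by blast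
  then have "v = ascending (eigs A)"
    using eigs_eq[OF hermitian_ex_eigenvalue_vec] by simp
  then show "v \<in> ascending_vecs (cdim TYPE('a))"
    using eigs_carrier[OF A(1)] by (simp add: ascending_vecs_def)
next
  fix v assume "v \<in> ascending_vecs (cdim TYPE('a))"
  then obtain a where a: "dim_vec a = cdim TYPE('a)" "v = ascending a"
    unfolding ascending_vecs_def by (metis carrier_vecD imageE)
  have dim: "dim_vec v = cdim TYPE('a)"
    by (simp add: a ascending_def)
  have mono: "\<forall>i j. i \<le> j \<longrightarrow> j < cdim TYPE('a) \<longrightarrow> v $ i \<le> v $ j"
    using a(1) by (simp add: a(2) ascending_def vec_of_list_index sorted_nth_mono)
  have "(\<lambda>x::'a. 0) \<in> hermitian_ops"
    by (simp add: hermitian_ops_def clinear_iff)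
  then obtain e :: "nat \<Rightarrow> 'a" where "orthonormal_frame e"
    using hermitian_ex_eigensystem frame_of_eigensystem by metis
  note D = diagonal_operator[OF this mono]
  have v: "vec (cdim TYPE('a)) (($) v) = v"
    using dim by (intro eq_vecI) auto
  then show "v \<in> eigs ` (hermitian_ops :: ('a \<Rightarrow> 'a) set)"
    using imageI[OF D(1), of eigs] by (simp only: D(2) v)
qed

section \<open>Unitary equivalence classes\<close>

lemma unitary_equiv_iff:
  fixes A B :: "'a::fin_dim_hilbert \<Rightarrow> 'a"
  shows "(A, B) \<in> unitary_equiv \<longleftrightarrow> A \<in> hermitian_ops \<and> B \<in> hermitian_ops \<and> eigs A = eigs B"
proof (intro iffI conjI)
  assume AB: "(A, B) \<in> unitary_equiv"
  then show A: "A \<in> hermitian_ops" and B: "B \<in> hermitian_ops"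
    by (auto simp: unitary_equiv_def)
  obtain U where U: "unitary_op U" "B = U \<circ> A \<circ> cadjoint U"
    using AB by (auto simp: unitary_equiv_def)
  have lin: "clinear U" using U(1) by (simp add: unitary_op_def)
  have UU: "cadjoint U (U x) = x" for x
    using U(1) by (metis comp_apply id_apply unitary_op_def)
  obtain e where e: "ordered_eigensystem A (eigs A) e"
    using hermitian_ex_eigensystem[OF A] by metis
  \<comment> \<open>A unitary carries an eigenbasis of \<open>A\<close> to one of \<open>B\<close>
    with the same eigenvalues.\<close>
  have "ordered_eigensystem B (eigs A) (U \<circ> e)"
    using e unfolding ordered_eigensystem_def
    by (simp add: U(2) UU unitary_op_cinner[OF U(1)] clinear_scaleC[OF lin])
  then show "eigs A = eigs B"
    using eigs_eigensystem[OF B] by simp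
next
  assume "A \<in> hermitian_ops \<and> B \<in> hermitian_ops \<and> eigs A = eigs B"
  then have A: "A \<in> hermitian_ops" and B: "B \<in> hermitian_ops" and eq: "eigs A = eigs B"
    by auto
  obtain e where e: "ordered_eigensystem A (eigs A) e"
    using hermitian_ex_eigensystem[OF A] by metis
  obtain d where d: "ordered_eigensystem B (eigs A) d"
    using hermitian_ex_eigensystem[OF B] eq by metis
  note fe = frame_of_eigensystem[OF e] and fd = frame_of_eigensystem[OF d]
  have lin: "clinear A" "clinear B"
    using A B by (auto simp: hermitian_ops_def)
  \<comment> \<open>Conversely, equal eigenvalue vectors allow eigenbases to be matched index by
    index; the change of basis is the required unitary.\<close>
  define U where "U = (\<lambda>x. \<Sum>i<cdim TYPE('a). cinner (e i) x *\<^sub>C d i)"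
  have U: "unitary_op U" "cadjoint U = (\<lambda>y. \<Sum>i<cdim TYPE('a). cinner (d i) y *\<^sub>C e i)"
    unfolding U_def by (rule frame_change_unitary[OF fe fd])+
  have "B y = (U \<circ> A \<circ> cadjoint U) y" for y
  proof -
    have "A (cadjoint U y)
        = (\<Sum>i<cdim TYPE('a). (cinner (d i) y * complex_of_real (eigs A $ i)) *\<^sub>C e i)"
      using e by (simp add: U(2) clinear_sum[OF lin(1)] clinear_scaleC[OF lin(1)] scaleC_scaleC
          ordered_eigensystem_def)
    then have "U (A (cadjoint U y))
        = (\<Sum>i<cdim TYPE('a). (cinner (d i) y * complex_of_real (eigs A $ i)) *\<^sub>C d i)"
      by (simp add: U_def frame_cinner_sum[OF fe])
    also have "\<dots> = B y"
      unfolding clinear_frame_expand[OF fd lin(2), of y]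
      using d by (simp add: ordered_eigensystem_def scaleC_scaleC)
    finally show ?thesis by simp
  qed
  then show "(A, B) \<in> unitary_equiv"
    using A B U(1) unfolding unitary_equiv_def by blast
qed

lemma uclass_eq: "A \<in> hermitian_ops \<Longrightarrow> uclass A = {B \<in> hermitian_ops. eigs B = eigs A}"
  by (auto simp: uclass_def unitary_equiv_iff)

lemma uclass_refl: "A \<in> hermitian_ops \<Longrightarrow> A \<in> uclass A"
  by (simp add: uclass_eq)

lemma uclass_eq_iff:
  "A \<in> hermitian_ops \<Longrightarrow> B \<in> hermitian_ops \<Longrightarrow> uclass A = uclass B \<longleftrightarrow> eigs A = eigs B"
  by (auto simp: uclass_eq)

text \<open>All representatives share the same \<open>eigs\<close>, so the definite description has
  exactly one solution.\<close>

lemma spectral_map_uclass: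
  assumes A: "A \<in> hermitian_ops"
  shows "spectral_map (uclass A) = eigs A"
  unfolding spectral_map_def
proof (rule the_equality)
  show "\<exists>B\<in>uclass A. \<exists>a. eigenvalue_vec B a \<and> eigs A = ascending a"
    using uclass_refl[OF A] hermitian_ex_eigenvalue_vec[OF A]
      eigs_eq[OF hermitian_ex_eigenvalue_vec[OF A]] by metis
next
  fix v assume "\<exists>B\<in>uclass A. \<exists>a. eigenvalue_vec B a \<and> v = ascending a"
  then obtain B a where "B \<in> uclass A" "eigenvalue_vec B a" "v = ascending a"
    by blast
  then show "v = eigs A"
    using eigs_eq[of B a] A by (simp add: uclass_eq)
qed

lemma quotient_unitary_equiv: "hermitian_ops // unitary_equiv = uclass ` hermitian_ops"
  by (auto simp: quotient_def uclass_def)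

text \<open>The classes are the fibres of \<open>eigs\<close>, which gives injectivity;
  \<open>eigs_range\<close> gives surjectivity.\<close>

lemma bij_betw_spectral_map:
  "bij_betw spectral_map (hermitian_ops // unitary_equiv :: ('a::fin_dim_hilbert \<Rightarrow> 'a) set set)
     (ascending_vecs (cdim TYPE('a)))"
  unfolding bij_betw_def
proof
  show "inj_on spectral_map (hermitian_ops // unitary_equiv :: ('a \<Rightarrow> 'a) set set)"
    by (auto simp: inj_on_def quotient_unitary_equiv spectral_map_uclass uclass_eq_iff)
  show "spectral_map ` (hermitian_ops // unitary_equiv :: ('a \<Rightarrow> 'a) set set)
      = ascending_vecs (cdim TYPE('a))"
    unfolding eigs_range[symmetric] quotient_unitary_equiv image_image
    by (intro image_cong refl spectral_map_uclass)
qed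

section \<open>Compatibility with the operations on classes\<close>

lemma uclass_eigensystem:
  assumes "A \<in> hermitian_ops" "B \<in> uclass A" "ordered_eigensystem B b e"
  shows "b = eigs A"
  using assms eigs_eigensystem[of B b e] by (simp add: uclass_eq)

lemma eigs_mono:
  fixes A :: "'a::fin_dim_hilbert \<Rightarrow> 'a"
  assumes "A \<in> hermitian_ops" "i \<le> j" "j < cdim TYPE('a)"
  shows "eigs A $ i \<le> eigs A $ j"
proof -
  obtain e where "ordered_eigensystem A (eigs A) e"
    using hermitian_ex_eigensystem[OF assms(1)] .
  then show ?thesis
    using assms(2,3) by (simp add: ordered_eigensystem_def)
qed

lemma spectral_map_class_add:
  fixes A B :: "'a::fin_dim_hilbert \<Rightarrow> 'a"
  assumes A: "A \<in> hermitian_ops" and B: "B \<in> hermitian_ops"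
  shows "spectral_map (class_add (uclass A) (uclass B)) = eigs A + eigs B"
proof -
  define D where "D e = (\<lambda>x. \<Sum>i<cdim TYPE('a).
      complex_of_real (eigs A $ i + eigs B $ i) *\<^sub>C ket_bra (e i) (e i) x)" for e :: "nat \<Rightarrow> 'a"
  have sum: "vec (cdim TYPE('a)) (\<lambda>i. eigs A $ i + eigs B $ i) = eigs A + eigs B"
    using eigs_carrier[OF A] eigs_carrier[OF B] by (intro eq_vecI) auto
  \<comment> \<open>A sum of ascending vectors is ascending, so no sorting intervenes.\<close>
  have D: "D e \<in> hermitian_ops" "eigs (D e) = eigs A + eigs B" if "orthonormal_frame e" for e
    unfolding D_def sum[symmetric]
    by (rule diagonal_operator[OF that]; simp add: add_mono eigs_mono A B)+
  obtain e where e: "ordered_eigensystem A (eigs A) e"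
    using hermitian_ex_eigensystem[OF A] by metis
  obtain d where d: "ordered_eigensystem B (eigs B) d"
    using hermitian_ex_eigensystem[OF B] by metis
  note De = D[OF frame_of_eigensystem[OF e]]
  have "class_add (uclass A) (uclass B) = uclass (D e)"
    unfolding class_add_def
  proof (rule the_equality, goal_cases)
    case 1
    show ?case
      using e d uclass_refl[OF A] uclass_refl[OF B] unfolding D_def by blast
  next
    case (2 C)
    then obtain A' B' a e' b d' where *: "A' \<in> uclass A" "B' \<in> uclass B"
      "ordered_eigensystem A' a e'" "ordered_eigensystem B' b d'"
      "C = uclass (\<lambda>x. \<Sum>i<cdim TYPE('a).
        complex_of_real (a $ i + b $ i) *\<^sub>C ket_bra (e' i) (e' i) x)"
      by blast
    \<comment> \<open>Other representatives and eigenbases change only the frame, and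
      \<open>eigs (D e)\<close> is the same for every frame.\<close>
    have "C = uclass (D e')"
      unfolding D_def *(5) uclass_eigensystem[OF A *(1,3)] uclass_eigensystem[OF B *(2,4)] ..
    then show ?case
      using D[OF frame_of_eigensystem[OF *(3)]] De by (simp add: uclass_eq_iff)
  qed
  then show ?thesis
    using De by (simp add: spectral_map_uclass)
qed

lemma spectral_map_class_scale:
  fixes A :: "'a::fin_dim_hilbert \<Rightarrow> 'a"
  assumes A: "A \<in> hermitian_ops" and k: "k \<ge> 0"
  shows "spectral_map (class_scale k (uclass A)) = k \<cdot>\<^sub>v eigs A"
proof -
  define D where "D e = (\<lambda>x. complex_of_real k *\<^sub>C (\<Sum>i<cdim TYPE('a).
      complex_of_real (eigs A $ i) *\<^sub>C ket_bra (e i) (e i) x))" for e :: "nat \<Rightarrow> 'a"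
  \<comment> \<open>Moving \<open>k\<close> inside the sum gives a diagonal operator; its entries
    stay ascending because \<open>k\<close> is non-negative.\<close>
  have D_eq: "D e = (\<lambda>x. \<Sum>i<cdim TYPE('a).
      complex_of_real (k * eigs A $ i) *\<^sub>C ket_bra (e i) (e i) x)" for e
    by (simp add: D_def complex_vector.scale_sum_right scaleC_scaleC)
  have scale: "vec (cdim TYPE('a)) (\<lambda>i. k * eigs A $ i) = k \<cdot>\<^sub>v eigs A"
    using eigs_carrier[OF A] by (intro eq_vecI) auto
  have D: "D e \<in> hermitian_ops" "eigs (D e) = k \<cdot>\<^sub>v eigs A" if "orthonormal_frame e" for e
    unfolding D_eq scale[symmetric]
    by (rule diagonal_operator[OF that]; simp add: mult_left_mono eigs_mono A k)+
  obtain e where e: "ordered_eigensystem A (eigs A) e"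
    using hermitian_ex_eigensystem[OF A] by metis
  note De = D[OF frame_of_eigensystem[OF e]]
  have "class_scale k (uclass A) = uclass (D e)"
    unfolding class_scale_def
  proof (rule the_equality, goal_cases)
    case 1
    show ?case
      using e uclass_refl[OF A] unfolding D_def by blast
  next
    case (2 C)
    then obtain A' a e' where *: "A' \<in> uclass A" "ordered_eigensystem A' a e'"
      "C = uclass (\<lambda>x. complex_of_real k *\<^sub>C (\<Sum>i<cdim TYPE('a).
        complex_of_real (a $ i) *\<^sub>C ket_bra (e' i) (e' i) x))"
      by blast
    have "C = uclass (D e')"
      unfolding D_def *(3) uclass_eigensystem[OF A *(1,2)] ..
    then show ?case
      using D[OF frame_of_eigensystem[OF *(2)]] De by (simp add: uclass_eq_iff)
  qed
  then show ?thesis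
    using De by (simp add: spectral_map_uclass)
qed

text \<open>Since \<open>spectral_map\<close> is a definite description, well-definedness is spelled
  out: eigenvalue vectors exist, their sorted form is constant on classes, and \<open>f\<close>
  takes that value.\<close>

theorem mainTheorem1:
  fixes n :: nat
    and M :: "('a::fin_dim_hilbert \<Rightarrow> 'a) set"
    and f :: "('a \<Rightarrow> 'a) set \<Rightarrow> real vec"
  assumes n: "n = cdim TYPE('a)"
    and M: "M = hermitian_ops"
    and f: "f = spectral_map"
  shows
    "(\<forall>A\<in>M. \<exists>a. eigenvalue_vec A a) \<and>
     (\<forall>A\<in>M. \<forall>B\<in>M. \<forall>a b. (A, B) \<in> unitary_equiv \<longrightarrow> eigenvalue_vec A a \<longrightarrow> eigenvalue_vec B b \<longrightarrow>
        ascending a = ascending b) \<and>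
     (\<forall>A\<in>M. \<forall>a. eigenvalue_vec A a \<longrightarrow> f (uclass A) = ascending a) \<and>
     bij_betw f (M // unitary_equiv) (ascending_vecs n) \<and>
     (\<forall>A\<in>M. \<forall>B\<in>M. f (class_add (uclass A) (uclass B)) = f (uclass A) + f (uclass B)) \<and>
     (\<forall>A\<in>M. \<forall>k::real. k \<ge> 0 \<longrightarrow> f (class_scale k (uclass A)) = k \<cdot>\<^sub>v f (uclass A)) \<and>
     (\<forall>A\<in>M. \<forall>B\<in>M. \<forall>a b. eigenvalue_vec A a \<longrightarrow> eigenvalue_vec B b \<longrightarrow>
        (uclass A = uclass B \<longleftrightarrow> ascending a = ascending b))"
  unfolding n M f
proof (intro conjI ballI allI impI)
  fix A B :: "'a \<Rightarrow> 'a"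
  assume A: "A \<in> hermitian_ops" and B: "B \<in> hermitian_ops"
  show "spectral_map (class_add (uclass A) (uclass B)) = spectral_map (uclass A) + spectral_map (uclass B)"
    by (simp add: A B spectral_map_class_add spectral_map_uclass)
  fix a b
  assume "eigenvalue_vec A a" "eigenvalue_vec B b"
  then show "uclass A = uclass B \<longleftrightarrow> ascending a = ascending b"
    using A B uclass_eq_iff eigs_eq by metis
  assume "(A, B) \<in> unitary_equiv"
  then show "ascending a = ascending b"
    using \<open>eigenvalue_vec A a\<close> \<open>eigenvalue_vec B b\<close> eigs_eq unitary_equiv_iff by metis
next
  fix A :: "'a \<Rightarrow> 'a"
  assume A: "A \<in> hermitian_ops"
  then show "\<exists>a. eigenvalue_vec A a"
    using hermitian_ex_eigenvalue_vec by blast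
  show "spectral_map (uclass A) = ascending a" if "eigenvalue_vec A a" for a
    using A that by (simp add: spectral_map_uclass eigs_eq)
  show "spectral_map (class_scale k (uclass A)) = k \<cdot>\<^sub>v spectral_map (uclass A)" if "k \<ge> 0" for k
    using A that by (simp add: spectral_map_class_scale spectral_map_uclass)
qed (rule bij_betw_spectral_map)

end
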